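(* Let $\sigma>0$, $\kappa<0$, $\alpha\in[0,1)$, and let $Z_1,Z_2,\dots$ be i.i.d. standard normal random variables. Put $S_0=0$, $S_n=\sigma\sum_{i=1}^n Z_i-\kappa\sigma n^{\alpha}$ for $n\ge1$ (with $n^0=1$), and $L_N=\max_{0\le j\le N}S_j$. Then, as $N\to\infty$, $\mathbf{E}[L_N]$ grows on the order of $\sigma|\kappa|N^{\alpha}$ when $\alpha\in(\tfrac12,1)$, on the order of $\sigma G(0)\sqrt N$ when $\alpha\in[0,\tfrac12)$, and on the order of $\sigma G(\kappa)\sqrt N$ when $\alpha=\tfrac12$. In particular, the following lower bounds hold for all sufficiently large $N$: $$\mathbf{E}[L_N]\ge\max_{0\le n\le N}\mathbf{E}[S_n^+],\ \text{ with }\ \max_{0\le n\le N}\mathbf{E}[S_n^+]\sim\sigma|\kappa|N^{\alpha}\ (N\to\infty),\quad\text{if }\alpha\in(\tfrac12,1);$$ $$\mathbf{E}[L_N]\ge\sigma G(\kappa)\sqrt N\ \text{ if }\alpha=\tfrac12;\qquad \mathbf{E}[L_N]\ge\sigma G(0)\sqrt N\ \text{ if }\alpha\in[0,\tfrac12);$$ and the following upper bound holds: $$\mathbf{E}[L_N]\le 2\sigma G(0)\sqrt N+|\kappa|\sigma N^{\alpha}.$$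
   Context: $x^+:=\max\{x,0\}$. $\phi$ and $\Phi$ are the standard normal density and distribution functions, $\bar\Phi:=1-\Phi$, and $G(x):=\mathbf{E}[(Z-x)^+]=\phi(x)-x\bar\Phi(x)$ for $Z$ standard normal. "Grows on the order of $f(N)$" means that there are constants $0<c_1\le c_2<\infty$ independent of $N$ with $c_1 f(N)\le\mathbf{E}[L_N]\le c_2 f(N)$ for all sufficiently large $N$. $a_N\sim b_N$ means $a_N/b_N\to1$. *)

theory Defs
  imports "HOL-Probability.Probability"
begin

abbreviation std_normal_measure :: "real measure" where
  "std_normal_measure \<equiv> density lborel (\<lambda>z. ennreal (std_normal_density z))"

definition G :: "real \<Rightarrow> real" where
  "G x = (\<integral>z. max (z - x) 0 \<partial>std_normal_measure)"

(* At n = 0 the value is set explicitly: the drift term 0 powr \<alpha> plays no role. *)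
definition walk :: "real \<Rightarrow> real \<Rightarrow> real \<Rightarrow> (nat \<Rightarrow> 'a \<Rightarrow> real) \<Rightarrow> nat \<Rightarrow> 'a \<Rightarrow> real" where
  "walk \<sigma> \<kappa> \<alpha> Z n \<omega> =
     (if n = 0 then 0 else \<sigma> * (\<Sum>i=1..n. Z i \<omega>) - \<kappa> * \<sigma> * real n powr \<alpha>)"

definition walk_max :: "real \<Rightarrow> real \<Rightarrow> real \<Rightarrow> (nat \<Rightarrow> 'a \<Rightarrow> real) \<Rightarrow> nat \<Rightarrow> 'a \<Rightarrow> real" where
  "walk_max \<sigma> \<kappa> \<alpha> Z N \<omega> = Max ((\<lambda>j. walk \<sigma> \<kappa> \<alpha> Z j \<omega>) ` {0..N})"

definition grows_on_order :: "(nat \<Rightarrow> real) \<Rightarrow> (nat \<Rightarrow> real) \<Rightarrow> bool" where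
  "grows_on_order a f \<longleftrightarrow>
     (\<exists>c1 c2. 0 < c1 \<and> c1 \<le> c2 \<and>
        (\<forall>\<^sub>F N in sequentially. c1 * f N \<le> a N \<and> a N \<le> c2 * f N))"

lemma G_eq:
  "G x = std_normal_density x - x * measure std_normal_measure {x<..}"
proof -
  let ?\<phi> = std_normal_density
  have int0: "set_integrable lborel {x<..} ?\<phi>"
    unfolding set_integrable_def by (intro integrable_mult_indicator) auto
  have int1: "set_integrable lborel {x<..} (\<lambda>z. ?\<phi> z * z)"
    unfolding set_integrable_def
    by (intro integrable_mult_indicator) (auto simp: integrable_normal_moment_nz_1)
  have e: "einterval (ereal x) \<infinity> = {x<..}"
    by (auto simp: einterval_def)
  have der: "((\<lambda>z. - ?\<phi> z) has_vector_derivative ?\<phi> z * z) (at z)" for z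
    unfolding has_real_derivative_iff_has_vector_derivative[symmetric] std_normal_density_def
    by (auto intro!: derivative_eq_intros simp: field_simps power2_eq_square)
  have cont: "isCont (\<lambda>z. ?\<phi> z * z) z" for z
    unfolding std_normal_density_def by (intro continuous_intros) auto
  have lim: "((\<lambda>z. - ?\<phi> z) \<longlongrightarrow> 0) at_top"
  proof -
    have "filterlim (\<lambda>z::real. z\<^sup>2 / 2) at_top at_top"
      by (intro filterlim_at_top_mult_tendsto_pos[where c="1/2" and f="\<lambda>_. 1/2", simplified]
                filterlim_pow_at_top filterlim_ident) auto
    hence "filterlim (\<lambda>z::real. - z\<^sup>2 / 2) at_bot at_top"
      by (simp add: filterlim_uminus_at_top)
    hence "((\<lambda>z::real. exp (- z\<^sup>2 / 2)) \<longlongrightarrow> 0) at_top"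
      by (rule filterlim_compose[OF exp_at_bot])
    hence "((\<lambda>z::real. - ((1 / sqrt (2 * pi)) * exp (- z\<^sup>2 / 2))) \<longlongrightarrow> - ((1 / sqrt (2 * pi)) * 0)) at_top"
      by (intro tendsto_intros)
    thus ?thesis by (simp add: std_normal_density_def)
  qed
  have A: "(((\<lambda>z. - ?\<phi> z) \<circ> real_of_ereal) \<longlongrightarrow> - ?\<phi> x) (at_right (ereal x))"
    unfolding ereal_tendsto_simps1
    using der[THEN has_vector_derivative_continuous, of x]
    by (auto simp: continuous_within intro: tendsto_within_subset)
  have B: "(((\<lambda>z. - ?\<phi> z) \<circ> real_of_ereal) \<longlongrightarrow> 0) (at_left \<infinity>)"
    using lim by (simp add: ereal_tendsto_simps1)
  have "(LBINT z=ereal x..\<infinity>. ?\<phi> z * z) = 0 - - ?\<phi> x"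
    by (rule interval_integral_FTC_integrable[where F="\<lambda>z. - ?\<phi> z"])
       (use der cont int1 A B in \<open>auto simp: e\<close>)
  hence I1: "(LINT z:{x<..}|lborel. ?\<phi> z * z) = ?\<phi> x"
    by (simp add: interval_lebesgue_integral_def e)
  have I0: "(LINT z:{x<..}|lborel. ?\<phi> z) = measure std_normal_measure {x<..}"
  proof -
    have "emeasure std_normal_measure {x<..} = (\<integral>\<^sup>+z. ennreal (indicator {x<..} z * ?\<phi> z) \<partial>lborel)"
      by (subst emeasure_density) (auto intro!: nn_integral_cong simp: indicator_def)
    also have "\<dots> = ennreal (LINT z:{x<..}|lborel. ?\<phi> z)"
      unfolding set_lebesgue_integral_def real_scaleR_def
      by (rule nn_integral_eq_integral) (use int0 in \<open>auto simp: set_integrable_def\<close>)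
    finally show ?thesis
      by (simp add: measure_def set_lebesgue_integral_def integral_nonneg_AE)
  qed
  have "G x = (\<integral>z. ?\<phi> z * max (z - x) 0 \<partial>lborel)"
    unfolding G_def by (subst integral_density) auto
  also have "\<dots> = (LINT z:{x<..}|lborel. ?\<phi> z * z - x * ?\<phi> z)"
    unfolding set_lebesgue_integral_def
    by (intro Bochner_Integration.integral_cong) (auto simp: indicator_def algebra_simps)
  also have "\<dots> = ?\<phi> x - x * measure std_normal_measure {x<..}"
    using int0 int1 I0 I1 by (subst set_integral_diff) auto
  finally show ?thesis .
qed

end

theory Submission
  imports Defs
begin

text \<open>
  Write \<open>W\<^sub>n = Z\<^sub>1 + \<dots> + Z\<^sub>n\<close>, so that \<open>S\<^sub>n = \<sigma> W\<^sub>n + \<bar>\<kappa>\<bar> \<sigma> n\<^sup>\<alpha>\<close>: the drift is nonnegative and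
  nondecreasing in \<open>n\<close>.

  All lower bounds come from \<open>L\<^sub>N \<ge> max (S\<^sub>n) 0\<close> for each \<open>n \<le> N\<close>, and mostly from \<open>n = N\<close> alone.
  For \<open>\<alpha> > 1/2\<close> one drops the positive part and keeps the mean \<open>\<bar>\<kappa>\<bar> \<sigma> N\<^sup>\<alpha>\<close>; for \<open>\<alpha> < 1/2\<close> one drops
  the drift and keeps \<open>\<sigma> E (max (W\<^sub>N) 0) = \<sigma> G(0) \<surd>N\<close>; for \<open>\<alpha> = 1/2\<close> the drift has exactly the
  scale of the standard deviation, and rescaling gives \<open>\<sigma> G(\<kappa>) \<surd>N\<close>.

  The upper bound replaces the drift by its final value, which leaves
  \<open>E (max\<^sub>j\<^sub>\<le>\<^sub>N W\<^sub>j) \<le> E \<bar>W\<^sub>N\<bar> = 2 G(0) \<surd>N\<close> to be shown.  This inequality holds for every random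
  walk with independent, symmetric, integrable steps (\<open>expectation_Max_partial_sums_le\<close>).
  It is proved by comparing the drawdown \<open>D\<^sub>n = max\<^sub>j\<^sub>\<le>\<^sub>n W\<^sub>j - W\<^sub>n\<close>, which has mean
  \<open>E (max\<^sub>j\<^sub>\<le>\<^sub>n W\<^sub>j)\<close>, with the walk itself.  The drawdown is again a Markov chain,
  \<open>D\<^sub>n\<^sub>+\<^sub>1 = max (D\<^sub>n - Z\<^sub>n\<^sub>+\<^sub>1) 0\<close>, and truncating at \<open>0\<close> only decreases the value of an even convex
  function \<open>f\<close>.  Since averaging over a symmetric step turns even convex functions into even convex
  functions, induction gives \<open>E f(D\<^sub>n) \<le> E f(W\<^sub>n)\<close> for all of them, and \<open>f = abs\<close> is the claim.

  The orders of growth follow from the two bounds because \<open>\<surd>N \<le> N\<^sup>\<alpha>\<close> for \<open>\<alpha> \<ge> 1/2\<close> and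
  \<open>N\<^sup>\<alpha> \<le> \<surd>N\<close> for \<open>\<alpha> \<le> 1/2\<close>.
\<close>

section \<open>Even convex functions\<close>

text \<open>
  The Lipschitz condition makes \<open>f \<circ> X\<close> integrable for every integrable \<open>X\<close> and is inherited by
  averages; its constant \<open>1\<close> is that of \<open>abs\<close>.
\<close>

definition even_convex :: "(real \<Rightarrow> real) \<Rightarrow> bool" where
  "even_convex f \<longleftrightarrow> convex_on UNIV f \<and> (\<forall>x. f (- x) = f x) \<and> (\<forall>x y. \<bar>f x - f y\<bar> \<le> \<bar>x - y\<bar>)"

lemma even_convex_abs: "even_convex abs"
proof -
  have "convex_on UNIV (abs :: real \<Rightarrow> real)"
  proof (rule convex_onI)
    fix t x y :: real
    assume "0 < t" "t < 1"
    then show "\<bar>(1 - t) *\<^sub>R x + t *\<^sub>R y\<bar> \<le> (1 - t) * \<bar>x\<bar> + t * \<bar>y\<bar>"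
      using abs_triangle_ineq[of "(1 - t) * x" "t * y"] by (simp add: abs_mult)
  qed simp
  then show ?thesis
    unfolding even_convex_def by (auto simp: abs_triangle_ineq3)
qed

lemma even_convex_measurable:
  assumes "even_convex f"
  shows "f \<in> borel_measurable borel"
proof -
  have "continuous_on UNIV f"
    using assms unfolding even_convex_def by (intro convex_on_continuous) auto
  then show ?thesis by (rule borel_measurable_continuous_onI)
qed

lemma even_convex_integrable:
  assumes f: "even_convex f" and X: "integrable M X" and M: "finite_measure M"
  shows "integrable M (\<lambda>\<omega>. f (X \<omega>))"
proof (rule Bochner_Integration.integrable_bound)
  interpret finite_measure M by (rule M)
  show "integrable M (\<lambda>\<omega>. \<bar>f 0\<bar> + \<bar>X \<omega>\<bar>)"
    using X by auto
  show "(\<lambda>\<omega>. f (X \<omega>)) \<in> borel_measurable M"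
    using even_convex_measurable[OF f] X by measurable
  have "\<bar>f x\<bar> \<le> \<bar>f 0\<bar> + \<bar>x\<bar>" for x
    using f unfolding even_convex_def by (smt (verit, best))
  then show "AE \<omega> in M. norm (f (X \<omega>)) \<le> norm (\<bar>f 0\<bar> + \<bar>X \<omega>\<bar>)"
    by auto
qed

text \<open>A convex function that is even has its minimum at \<open>0\<close>, the midpoint of \<open>x\<close> and \<open>- x\<close>.\<close>

lemma even_convex_truncate_le:
  assumes f: "even_convex f"
  shows "f (max x 0) \<le> f x"
proof -
  have "f ((1 - 1/2) *\<^sub>R x + (1/2) *\<^sub>R (- x)) \<le> (1 - 1/2) * f x + (1/2) * f (- x)"
    using f unfolding even_convex_def by (intro convex_onD[where A=UNIV]) auto
  then have "f 0 \<le> f x"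
    using f unfolding even_convex_def by simp
  then show ?thesis by (auto simp: max_def)
qed

section \<open>Averaging over an independent symmetric step\<close>

context prob_space
begin

lemma expectation_symmetric:
  fixes Y :: "'a \<Rightarrow> real" and g :: "real \<Rightarrow> real"
  assumes sym: "distr M borel (\<lambda>\<omega>. - Y \<omega>) = distr M borel Y"
    and [measurable]: "random_variable borel Y" "g \<in> borel_measurable borel"
  shows "expectation (\<lambda>\<omega>. g (- Y \<omega>)) = expectation (\<lambda>\<omega>. g (Y \<omega>))"
proof -
  have "expectation (\<lambda>\<omega>. g (- Y \<omega>)) = (\<integral>y. g y \<partial>distr M borel (\<lambda>\<omega>. - Y \<omega>))"
    by (subst integral_distr) auto
  also have "\<dots> = expectation (\<lambda>\<omega>. g (Y \<omega>))"
    unfolding sym by (subst integral_distr) auto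
  finally show ?thesis .
qed

text \<open>
  Translation and averaging keep convexity and the Lipschitz bound for any step; evenness survives
  because \<open>f (- x + Y) = f (x - Y)\<close>, and \<open>- Y\<close> has the law of \<open>Y\<close>.
\<close>

lemma even_convex_average:
  fixes Y :: "'a \<Rightarrow> real"
  assumes f: "even_convex f" and Y: "integrable M Y"
    and sym: "distr M borel (\<lambda>\<omega>. - Y \<omega>) = distr M borel Y"
  shows "even_convex (\<lambda>x. expectation (\<lambda>\<omega>. f (x + Y \<omega>)))"
proof -
  have [measurable]: "random_variable borel Y" "f \<in> borel_measurable borel"
    using Y even_convex_measurable[OF f] by auto
  have int: "integrable M (\<lambda>\<omega>. f (x + Y \<omega>))" for x
    using Y by (intro even_convex_integrable[OF f]) (auto intro: finite_measure_axioms)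
  have even: "f (- x) = f x" for x
    using f by (simp add: even_convex_def)
  have lip: "\<bar>f x - f y\<bar> \<le> \<bar>x - y\<bar>" for x y
    using f by (simp add: even_convex_def)
  have "convex_on UNIV (\<lambda>x. expectation (\<lambda>\<omega>. f (x + Y \<omega>)))"
  proof (rule convex_onI)
    fix t x y :: real
    assume t: "0 < t" "t < 1"
    have "f (((1 - t) *\<^sub>R x + t *\<^sub>R y) + z) \<le> (1 - t) * f (x + z) + t * f (y + z)" for z
    proof -
      have "f ((1 - t) *\<^sub>R (x + z) + t *\<^sub>R (y + z)) \<le> (1 - t) * f (x + z) + t * f (y + z)"
        using f t unfolding even_convex_def by (intro convex_onD[where A=UNIV]) auto
      moreover have "(1 - t) *\<^sub>R (x + z) + t *\<^sub>R (y + z) = ((1 - t) *\<^sub>R x + t *\<^sub>R y) + z"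
        by (simp add: algebra_simps)
      ultimately show ?thesis by simp
    qed
    then have "expectation (\<lambda>\<omega>. f (((1 - t) *\<^sub>R x + t *\<^sub>R y) + Y \<omega>))
        \<le> expectation (\<lambda>\<omega>. (1 - t) * f (x + Y \<omega>) + t * f (y + Y \<omega>))"
      by (intro integral_mono int Bochner_Integration.integrable_add integrable_mult_right) auto
    also have "\<dots> = (1 - t) * expectation (\<lambda>\<omega>. f (x + Y \<omega>)) + t * expectation (\<lambda>\<omega>. f (y + Y \<omega>))"
      by (simp add: int)
    finally show "expectation (\<lambda>\<omega>. f (((1 - t) *\<^sub>R x + t *\<^sub>R y) + Y \<omega>)) \<le> \<dots>" .
  qed auto
  moreover have "expectation (\<lambda>\<omega>. f (- x + Y \<omega>)) = expectation (\<lambda>\<omega>. f (x + Y \<omega>))" for x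
  proof -
    have "expectation (\<lambda>\<omega>. f (- x + Y \<omega>)) = expectation (\<lambda>\<omega>. f (x + - Y \<omega>))"
      using even[of "x - Y _"] by (intro Bochner_Integration.integral_cong) simp_all
    also have "\<dots> = expectation (\<lambda>\<omega>. f (x + Y \<omega>))"
      by (rule expectation_symmetric[OF sym, where g="\<lambda>y. f (x + y)"]) auto
    finally show ?thesis .
  qed
  moreover have "\<bar>expectation (\<lambda>\<omega>. f (x + Y \<omega>)) - expectation (\<lambda>\<omega>. f (y + Y \<omega>))\<bar> \<le> \<bar>x - y\<bar>" for x y
  proof -
    have "\<bar>expectation (\<lambda>\<omega>. f (x + Y \<omega>)) - expectation (\<lambda>\<omega>. f (y + Y \<omega>))\<bar>
        = \<bar>expectation (\<lambda>\<omega>. f (x + Y \<omega>) - f (y + Y \<omega>))\<bar>"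
      by (simp add: int)
    also have "\<dots> \<le> expectation (\<lambda>\<omega>. \<bar>f (x + Y \<omega>) - f (y + Y \<omega>)\<bar>)"
      by (rule integral_abs_bound)
    also have "\<dots> \<le> expectation (\<lambda>\<omega>. \<bar>x - y\<bar>)"
    proof (intro integral_mono)
      show "\<bar>f (x + Y \<omega>) - f (y + Y \<omega>)\<bar> \<le> \<bar>x - y\<bar>" for \<omega>
        using lip[of "x + Y \<omega>" "y + Y \<omega>"] by simp
    qed (auto simp: int)
    finally show ?thesis by (simp add: prob_space)
  qed
  ultimately show ?thesis
    unfolding even_convex_def by blast
qed

lemma expectation_indep_add:
  fixes X Y :: "'a \<Rightarrow> real" and f :: "real \<Rightarrow> real"
  assumes ind: "indep_var borel X borel Y"
    and [measurable]: "f \<in> borel_measurable borel"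
    and int: "integrable M (\<lambda>\<omega>. f (X \<omega> + Y \<omega>))"
  shows "expectation (\<lambda>\<omega>. f (X \<omega> + Y \<omega>)) =
    expectation (\<lambda>\<omega>. expectation (\<lambda>\<omega>'. f (X \<omega> + Y \<omega>')))"
proof -
  have [measurable]: "random_variable borel X" "random_variable borel Y"
    and joint: "distr M borel X \<Otimes>\<^sub>M distr M borel Y = distr M (borel \<Otimes>\<^sub>M borel) (\<lambda>\<omega>. (X \<omega>, Y \<omega>))"
    using ind unfolding indep_var_distribution_eq by auto
  interpret X: prob_space "distr M borel X" by (rule prob_space_distr) simp
  interpret Y: prob_space "distr M borel Y" by (rule prob_space_distr) simp
  interpret XY: pair_prob_space "distr M borel X" "distr M borel Y" ..
  have "integrable (distr M borel X \<Otimes>\<^sub>M distr M borel Y) (\<lambda>p. f (fst p + snd p))"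
    unfolding joint by (subst integrable_distr_eq) (auto simp: int)
  then have "(\<integral>x. (\<integral>y. f (fst (x, y) + snd (x, y)) \<partial>distr M borel Y) \<partial>distr M borel X)
      = (\<integral>p. f (fst p + snd p) \<partial>(distr M borel X \<Otimes>\<^sub>M distr M borel Y))"
    by (rule XY.integral_fst')
  also have "\<dots> = expectation (\<lambda>\<omega>. f (X \<omega> + Y \<omega>))"
    unfolding joint by (subst integral_distr) auto
  finally have "expectation (\<lambda>\<omega>. f (X \<omega> + Y \<omega>))
      = (\<integral>x. (\<integral>y. f (x + y) \<partial>distr M borel Y) \<partial>distr M borel X)"
    by simp
  also have "\<dots> = expectation (\<lambda>\<omega>. \<integral>y. f (X \<omega> + y) \<partial>distr M borel Y)"
    by (subst integral_distr) (auto intro!: Y.borel_measurable_lebesgue_integral)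
  also have "\<dots> = expectation (\<lambda>\<omega>. expectation (\<lambda>\<omega>'. f (X \<omega> + Y \<omega>')))"
    by (subst integral_distr) auto
  finally show ?thesis .
qed

end

section \<open>The drawdown of a symmetric random walk\<close>

text \<open>
  The recursion involves only the current drawdown and the next step, not the running maximum;
  \<open>drawdown_eq_Max_minus\<close> identifies it as the distance of the walk below its maximum so far.
\<close>

fun drawdown :: "(nat \<Rightarrow> real) \<Rightarrow> nat \<Rightarrow> real" where
  "drawdown z 0 = 0"
| "drawdown z (Suc n) = max (drawdown z n - z (Suc n)) 0"

lemma drawdown_eq_Max_minus:
  "drawdown z n = Max ((\<lambda>j. \<Sum>i=1..j. z i) ` {0..n}) - (\<Sum>i=1..n. z i)"
proof (induction n)
  case (Suc n)
  have "Max ((\<lambda>j. \<Sum>i=1..j. z i) ` {0..Suc n})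
      = max (\<Sum>i=1..Suc n. z i) (Max ((\<lambda>j. \<Sum>i=1..j. z i) ` {0..n}))"
    by (simp add: atLeast0_atMost_Suc)
  then show ?case
    using Suc by (simp add: max_def)
qed simp

lemma drawdown_restrict:
  "n \<le> k \<Longrightarrow> drawdown (restrict z {1..k}) n = drawdown z n"
  by (induction n) auto

lemma drawdown_measurable_PiM:
  "n \<le> k \<Longrightarrow> (\<lambda>z. drawdown z n) \<in> borel_measurable (PiM {1..k} (\<lambda>_. borel))"
proof (induction n)
  case (Suc n)
  have [measurable]: "(\<lambda>z. drawdown z n) \<in> borel_measurable (PiM {1..k} (\<lambda>_. borel))"
    and [measurable]: "(\<lambda>z. z (Suc n)) \<in> borel_measurable (PiM {1..k} (\<lambda>_. borel :: real measure))"
    using Suc by (auto intro!: measurable_component_singleton)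
  show ?case unfolding drawdown.simps by measurable
qed simp

context prob_space
begin

text \<open>
  The drawdown and the partial sum are both functions of the first \<open>n\<close> steps; this is the
  independence from the next step that the induction uses for each of them.
\<close>

lemma indep_var_past_next:
  fixes Z :: "nat \<Rightarrow> 'a \<Rightarrow> real"
  assumes ind: "indep_vars (\<lambda>_. borel) Z {1..}"
    and g: "g \<in> borel_measurable (PiM {1..n} (\<lambda>_. borel))"
    and h: "h \<in> borel_measurable borel"
  shows "indep_var borel (\<lambda>\<omega>. g (restrict (\<lambda>i. Z i \<omega>) {1..n}))
    borel (\<lambda>\<omega>. h (Z (Suc n) \<omega>) :: real)"
proof -
  have "indep_var (PiM {1..n} (\<lambda>_. borel)) (\<lambda>\<omega>. restrict (\<lambda>i. Z i \<omega>) {1..n})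
      (PiM {Suc n} (\<lambda>_. borel)) (\<lambda>\<omega>. restrict (\<lambda>i. Z i \<omega>) {Suc n})"
    by (rule indep_var_restrict[OF ind]) auto
  moreover have "(\<lambda>z. h (z (Suc n))) \<in> borel_measurable (PiM {Suc n} (\<lambda>_. borel))"
    using h by measurable
  ultimately have "indep_var borel (g \<circ> (\<lambda>\<omega>. restrict (\<lambda>i. Z i \<omega>) {1..n}))
      borel ((\<lambda>z. h (z (Suc n))) \<circ> (\<lambda>\<omega>. restrict (\<lambda>i. Z i \<omega>) {Suc n}))"
    using g by (intro indep_var_compose)
  then show ?thesis by (simp add: comp_def)
qed

lemma integrable_drawdown:
  assumes "\<And>i. i \<ge> 1 \<Longrightarrow> integrable M (Z i)"
  shows "integrable M (\<lambda>\<omega>. drawdown (\<lambda>i. Z i \<omega>) n)"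
proof (induction n)
  case (Suc n)
  then show ?case
    unfolding drawdown.simps using assms[of "Suc n"]
    by (intro integrable_max Bochner_Integration.integrable_diff integrable_zero) auto
qed simp

text \<open>
  Generality in \<open>f\<close> is what makes the induction work: conditioning on the first \<open>n\<close> steps replaces
  \<open>f\<close> by its average over step \<open>n + 1\<close>, to which the induction hypothesis is applied.
\<close>

lemma expectation_even_convex_drawdown_le:
  fixes Z :: "nat \<Rightarrow> 'a \<Rightarrow> real"
  assumes ind: "indep_vars (\<lambda>_. borel) Z {1..}"
    and int: "\<And>i. i \<ge> 1 \<Longrightarrow> integrable M (Z i)"
    and sym: "\<And>i. i \<ge> 1 \<Longrightarrow> distr M borel (\<lambda>\<omega>. - Z i \<omega>) = distr M borel (Z i)"
    and f: "even_convex f"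
  shows "expectation (\<lambda>\<omega>. f (drawdown (\<lambda>i. Z i \<omega>) n)) \<le> expectation (\<lambda>\<omega>. f (\<Sum>i=1..n. Z i \<omega>))"
  using f
proof (induction n arbitrary: f)
  case (Suc n)
  note f = Suc.prems
  let ?D = "\<lambda>\<omega>. drawdown (\<lambda>i. Z i \<omega>) n" and ?W = "\<lambda>\<omega>. \<Sum>i=1..n. Z i \<omega>" and ?Y = "Z (Suc n)"
  define F where "F x = expectation (\<lambda>\<omega>. f (x + ?Y \<omega>))" for x
  have [measurable]: "f \<in> borel_measurable borel"
    by (rule even_convex_measurable[OF f])
  have Y: "integrable M ?Y" "distr M borel (\<lambda>\<omega>. - ?Y \<omega>) = distr M borel ?Y"
    using int sym by auto
  have [measurable]: "random_variable borel ?Y"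
    using Y by auto
  have D: "integrable M ?D" and W: "integrable M ?W"
    using int by (auto intro!: integrable_drawdown)
  note int_f = even_convex_integrable[OF f _ finite_measure_axioms]
  have F: "even_convex F"
    unfolding F_def by (rule even_convex_average[OF f Y])
  have indD: "indep_var borel ?D borel (\<lambda>\<omega>. - ?Y \<omega>)"
    using indep_var_past_next[OF ind drawdown_measurable_PiM[OF order_refl], of uminus n]
    by (simp only: drawdown_restrict[OF order_refl] measurable_ident_sets borel_measurable_uminus)
  have "(\<lambda>z. \<Sum>i=1..n. z i) \<in> borel_measurable (PiM {1..n} (\<lambda>_. borel :: real measure))"
    by measurable
  from indep_var_past_next[OF ind this, of "\<lambda>x. x"]
  have indW: "indep_var borel ?W borel ?Y"
    by simp
  have "expectation (\<lambda>\<omega>. f (drawdown (\<lambda>i. Z i \<omega>) (Suc n))) \<le> expectation (\<lambda>\<omega>. f (?D \<omega> + - ?Y \<omega>))"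
    using even_convex_truncate_le[OF f] D Y int_f by (intro integral_mono) auto
  also have "\<dots> = expectation (\<lambda>\<omega>. expectation (\<lambda>\<omega>'. f (?D \<omega> + - ?Y \<omega>')))"
    using D Y by (intro expectation_indep_add[OF indD] int_f) auto
  \<comment> \<open>The step enters the drawdown with the opposite sign to the walk; by symmetry both lead to the
    same average \<open>F\<close>.\<close>
  also have "\<dots> = expectation (\<lambda>\<omega>. F (?D \<omega>))"
    unfolding F_def
    by (intro Bochner_Integration.integral_cong refl
        expectation_symmetric[OF Y(2), where g="\<lambda>y. f (?D _ + y)"]) measurable
  also have "\<dots> \<le> expectation (\<lambda>\<omega>. F (?W \<omega>))"
    by (rule Suc.IH[OF F])
  also have "\<dots> = expectation (\<lambda>\<omega>. f (?W \<omega> + ?Y \<omega>))"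
    unfolding F_def using W Y by (intro expectation_indep_add[OF indW, symmetric] int_f) auto
  finally show ?case by simp
qed simp

text \<open>
  The steps have mean \<open>0\<close>, so the maximum and the drawdown have the same mean; the drawdown is
  nonnegative, so \<open>abs\<close> can be applied to it for free.
\<close>

theorem expectation_Max_partial_sums_le:
  fixes Z :: "nat \<Rightarrow> 'a \<Rightarrow> real"
  assumes ind: "indep_vars (\<lambda>_. borel) Z {1..}"
    and int: "\<And>i. i \<ge> 1 \<Longrightarrow> integrable M (Z i)"
    and sym: "\<And>i. i \<ge> 1 \<Longrightarrow> distr M borel (\<lambda>\<omega>. - Z i \<omega>) = distr M borel (Z i)"
  shows "expectation (\<lambda>\<omega>. Max ((\<lambda>j. \<Sum>i=1..j. Z i \<omega>) ` {0..n})) \<le> expectation (\<lambda>\<omega>. \<bar>\<Sum>i=1..n. Z i \<omega>\<bar>)"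
proof -
  have mean: "expectation (Z i) = 0" if "i \<ge> 1" for i
  proof -
    have "expectation (\<lambda>\<omega>. - Z i \<omega>) = expectation (Z i)"
      using int[OF that] by (intro expectation_symmetric[OF sym[OF that], of "\<lambda>x. x"]) auto
    then show ?thesis by simp
  qed
  have "expectation (\<lambda>\<omega>. Max ((\<lambda>j. \<Sum>i=1..j. Z i \<omega>) ` {0..n}))
      = expectation (\<lambda>\<omega>. drawdown (\<lambda>i. Z i \<omega>) n + (\<Sum>i=1..n. Z i \<omega>))"
    by (simp add: drawdown_eq_Max_minus)
  also have "\<dots> = expectation (\<lambda>\<omega>. drawdown (\<lambda>i. Z i \<omega>) n) + (\<Sum>i=1..n. expectation (Z i))"
    using int by (subst Bochner_Integration.integral_add) (auto intro!: integrable_drawdown)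
  also have "\<dots> = expectation (\<lambda>\<omega>. \<bar>drawdown (\<lambda>i. Z i \<omega>) n\<bar>)"
    by (cases n) (simp_all add: mean)
  also have "\<dots> \<le> expectation (\<lambda>\<omega>. \<bar>\<Sum>i=1..n. Z i \<omega>\<bar>)"
    by (rule expectation_even_convex_drawdown_le[OF ind int sym even_convex_abs])
  finally show ?thesis .
qed

end

section \<open>Gaussian steps\<close>

context prob_space
begin

lemma expectation_std_normal_pos_part:
  assumes X: "distributed M lborel X std_normal_density"
  shows "expectation (\<lambda>\<omega>. max (X \<omega> - x) 0) = G x"
proof -
  have [measurable]: "random_variable borel X"
    using distributed_measurable[OF X] by simp
  have "G x = (\<integral>z. max (z - x) 0 \<partial>distr M lborel X)"
    by (simp add: G_def distributed_distr_eq_density[OF X])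
  then show ?thesis
    by (subst (asm) integral_distr) auto
qed

lemma integrable_std_normal:
  assumes X: "distributed M lborel X std_normal_density"
  shows "integrable M X"
  using distributed_integrable[OF X, of "\<lambda>x. x"] integrable_std_normal_moment[of 1] by simp

lemma distr_uminus_std_normal:
  assumes X: "distributed M lborel X std_normal_density"
  shows "distr M borel (\<lambda>\<omega>. - X \<omega>) = distr M borel X"
proof -
  have "distributed M lborel (\<lambda>\<omega>. 0 + (-1) * X \<omega>) (normal_density (0 + (-1) * 0) (\<bar>-1\<bar> * 1))"
    by (rule normal_density_affine[OF X]) auto
  then have "distributed M lborel (\<lambda>\<omega>. - X \<omega>) std_normal_density"
    by simp
  then have "distr M lborel (\<lambda>\<omega>. - X \<omega>) = distr M lborel X"
    using X by (simp add: distributed_distr_eq_density)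
  moreover have "distr M borel Y = distr M lborel Y" for Y :: "'a \<Rightarrow> real"
    by (rule distr_cong) auto
  ultimately show ?thesis by simp
qed

text \<open>Pointwise \<open>\<bar>x\<bar> = 2 max x 0 - x\<close>, and the mean of \<open>X\<close> vanishes.\<close>

lemma expectation_abs_std_normal:
  assumes X: "distributed M lborel X std_normal_density"
  shows "expectation (\<lambda>\<omega>. \<bar>X \<omega>\<bar>) = 2 * G 0"
proof -
  have "expectation (\<lambda>\<omega>. \<bar>X \<omega>\<bar>) = expectation (\<lambda>\<omega>. 2 * max (X \<omega> - 0) 0 - X \<omega>)"
    by (intro Bochner_Integration.integral_cong) auto
  also have "\<dots> = 2 * expectation (\<lambda>\<omega>. max (X \<omega> - 0) 0) - expectation X"
    using integrable_std_normal[OF X]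
    by (subst Bochner_Integration.integral_diff) auto
  finally show ?thesis
    by (simp only: expectation_std_normal_pos_part[OF X] standard_normal_distributed_expectation[OF X])
qed

end

lemma G_0_pos: "G 0 > 0"
  by (simp add: G_eq std_normal_density_def)

lemma G_pos_if_nonpos: "x \<le> 0 \<Longrightarrow> G x > 0"
  unfolding G_eq using normal_density_pos[of 1 0 x]
  by (smt (verit) measure_nonneg mult_nonpos_nonneg)

locale gaussian_walk = prob_space M for M :: "'a measure" +
  fixes Z :: "nat \<Rightarrow> 'a \<Rightarrow> real" and \<sigma> \<kappa> \<alpha> :: real
  assumes \<sigma>_pos: "\<sigma> > 0" and \<kappa>_neg: "\<kappa> < 0" and \<alpha>_nonneg: "0 \<le> \<alpha>"
    and indep_steps: "indep_vars (\<lambda>_. borel) Z {1..}"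
    and step_distributed: "\<And>i. i \<ge> 1 \<Longrightarrow> distributed M lborel (Z i) std_normal_density"
begin

abbreviation S :: "nat \<Rightarrow> 'a \<Rightarrow> real" where "S \<equiv> walk \<sigma> \<kappa> \<alpha> Z"
abbreviation L :: "nat \<Rightarrow> 'a \<Rightarrow> real" where "L \<equiv> walk_max \<sigma> \<kappa> \<alpha> Z"

definition W :: "nat \<Rightarrow> 'a \<Rightarrow> real" where "W n \<omega> = (\<Sum>i=1..n. Z i \<omega>)"

lemma S_eq: "S n \<omega> = \<sigma> * W n \<omega> + \<bar>\<kappa>\<bar> * \<sigma> * real n powr \<alpha>"
  using \<kappa>_neg by (simp add: walk_def W_def)

lemma integrable_step: "i \<ge> 1 \<Longrightarrow> integrable M (Z i)"
  by (rule integrable_std_normal[OF step_distributed])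

lemma integrable_W: "integrable M (W n)"
  unfolding W_def by (auto intro!: integrable_step)

lemma integrable_S: "integrable M (S n)"
  unfolding S_eq[abs_def] using integrable_W by auto

lemma expectation_W: "expectation (W n) = 0"
  unfolding W_def using integrable_step
  by (subst Bochner_Integration.integral_sum)
    (auto intro!: sum.neutral standard_normal_distributed_expectation step_distributed)

lemma W_scaled_distributed:
  assumes "n \<ge> 1"
  shows "distributed M lborel (\<lambda>\<omega>. W n \<omega> / sqrt (real n)) std_normal_density"
proof -
  have "distributed M lborel (\<lambda>\<omega>. \<Sum>i\<in>{1..n}. Z i \<omega>)
      (normal_density (\<Sum>i\<in>{1..n}. 0) (sqrt (\<Sum>i\<in>{1..n}. 1\<^sup>2)))"
  proof (rule sum_indep_normal)
    show "indep_vars (\<lambda>i. borel) Z {1..n}"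
      by (rule indep_vars_subset[OF indep_steps]) auto
  qed (use assms step_distributed in auto)
  then have "distributed M lborel (W n) (normal_density 0 (sqrt (real n)))"
    by (simp add: W_def[abs_def])
  then show ?thesis
    using normal_standard_normal_convert[of "sqrt (real n)" "W n" 0] assms by simp
qed

lemma expectation_abs_W: "expectation (\<lambda>\<omega>. \<bar>W n \<omega>\<bar>) = 2 * G 0 * sqrt (real n)"
proof (cases "n = 0")
  case False
  then have "expectation (\<lambda>\<omega>. \<bar>W n \<omega>\<bar>) = expectation (\<lambda>\<omega>. \<bar>W n \<omega> / sqrt (real n)\<bar> * sqrt (real n))"
    by (intro Bochner_Integration.integral_cong) (auto simp: abs_divide)
  also have "\<dots> = 2 * G 0 * sqrt (real n)"
    using expectation_abs_std_normal[OF W_scaled_distributed[of n]] False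
    by (subst integral_mult_left_zero) simp
  finally show ?thesis .
qed (simp add: W_def)

lemma expectation_pos_part_W_shift:
  "expectation (\<lambda>\<omega>. max (W n \<omega> - x * sqrt (real n)) 0) = G x * sqrt (real n)"
proof (cases "n = 0")
  case False
  then have "expectation (\<lambda>\<omega>. max (W n \<omega> - x * sqrt (real n)) 0)
      = expectation (\<lambda>\<omega>. max (W n \<omega> / sqrt (real n) - x) 0 * sqrt (real n))"
    by (intro Bochner_Integration.integral_cong) (auto simp: max_def field_simps)
  also have "\<dots> = G x * sqrt (real n)"
    using expectation_std_normal_pos_part[OF W_scaled_distributed] False by simp
  finally show ?thesis .
qed (simp add: W_def)

section \<open>Lower and upper bounds for the expected maximum\<close>

lemma integrable_pos_part_S: "integrable M (\<lambda>\<omega>. max (S n \<omega>) 0)"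
  using integrable_S by auto

lemma expectation_scaled_pos_part_W:
  "expectation (\<lambda>\<omega>. \<sigma> * max (W n \<omega>) 0) = \<sigma> * G 0 * sqrt (real n)"
  using expectation_pos_part_W_shift[of n 0] by simp

text \<open>The next two bounds drop, respectively, the positive part and the (nonnegative) drift.\<close>

lemma drift_le_expectation_pos_part:
  "\<bar>\<kappa>\<bar> * \<sigma> * real n powr \<alpha> \<le> expectation (\<lambda>\<omega>. max (S n \<omega>) 0)"
proof -
  have "\<bar>\<kappa>\<bar> * \<sigma> * real n powr \<alpha> = expectation (S n)"
    unfolding S_eq[abs_def] using integrable_W expectation_W by (simp add: prob_space)
  also have "\<dots> \<le> expectation (\<lambda>\<omega>. max (S n \<omega>) 0)"
    by (intro integral_mono integrable_S integrable_pos_part_S) auto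
  finally show ?thesis .
qed

lemma fluctuation_le_expectation_pos_part:
  "\<sigma> * G 0 * sqrt (real n) \<le> expectation (\<lambda>\<omega>. max (S n \<omega>) 0)"
  unfolding expectation_scaled_pos_part_W[symmetric]
proof (intro integral_mono integrable_pos_part_S)
  show "integrable M (\<lambda>\<omega>. \<sigma> * max (W n \<omega>) 0)"
    using integrable_W by auto
  show "\<sigma> * max (W n \<omega>) 0 \<le> max (S n \<omega>) 0" for \<omega>
  proof -
    have "\<sigma> * max (W n \<omega>) 0 = max (\<sigma> * W n \<omega>) 0"
      using \<sigma>_pos by (simp add: max_mult_distrib_left)
    also have "\<dots> \<le> max (S n \<omega>) 0"
      using \<sigma>_pos by (intro max.mono) (auto simp: S_eq)
    finally show ?thesis .
  qed
qed

lemma expectation_pos_part_le: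
  "expectation (\<lambda>\<omega>. max (S n \<omega>) 0) \<le> \<sigma> * G 0 * sqrt (real n) + \<bar>\<kappa>\<bar> * \<sigma> * real n powr \<alpha>"
proof -
  have "expectation (\<lambda>\<omega>. max (S n \<omega>) 0)
      \<le> expectation (\<lambda>\<omega>. \<sigma> * max (W n \<omega>) 0 + \<bar>\<kappa>\<bar> * \<sigma> * real n powr \<alpha>)"
  proof (intro integral_mono integrable_pos_part_S)
    show "integrable M (\<lambda>\<omega>. \<sigma> * max (W n \<omega>) 0 + \<bar>\<kappa>\<bar> * \<sigma> * real n powr \<alpha>)"
      using integrable_W by auto
    show "max (S n \<omega>) 0 \<le> \<sigma> * max (W n \<omega>) 0 + \<bar>\<kappa>\<bar> * \<sigma> * real n powr \<alpha>" for \<omega>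
      unfolding S_eq using \<sigma>_pos by (intro max.boundedI add_right_mono add_nonneg_nonneg) auto
  qed
  also have "\<dots> = \<sigma> * G 0 * sqrt (real n) + \<bar>\<kappa>\<bar> * \<sigma> * real n powr \<alpha>"
    using integrable_W expectation_scaled_pos_part_W
    by (subst Bochner_Integration.integral_add) (auto simp: prob_space)
  finally show ?thesis .
qed

text \<open>For \<open>\<alpha> = 1/2\<close> the drift is a fixed multiple of the standard deviation \<open>\<surd>n\<close> of \<open>W n\<close>.\<close>

lemma expectation_pos_part_critical:
  assumes "\<alpha> = 1/2"
  shows "expectation (\<lambda>\<omega>. max (S n \<omega>) 0) = \<sigma> * G \<kappa> * sqrt (real n)"
proof -
  have "max (S n \<omega>) 0 = \<sigma> * max (W n \<omega> - \<kappa> * sqrt (real n)) 0" for \<omega>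
  proof -
    have "S n \<omega> = \<sigma> * (W n \<omega> - \<kappa> * sqrt (real n))"
      unfolding S_eq unfolding assms using \<kappa>_neg by (simp add: powr_half_sqrt algebra_simps)
    then show ?thesis
      using \<sigma>_pos by (simp add: max_def mult_le_0_iff zero_le_mult_iff)
  qed
  then show ?thesis
    using expectation_pos_part_W_shift[of n \<kappa>] by simp
qed

lemma integrable_L: "integrable M (L N)"
proof -
  have "integrable M (\<lambda>\<omega>. Max ((\<lambda>j. S j \<omega>) ` {0..N}))"
  proof (induction N)
    case (Suc N)
    have "Max ((\<lambda>j. S j \<omega>) ` {0..Suc N}) = max (S (Suc N) \<omega>) (Max ((\<lambda>j. S j \<omega>) ` {0..N}))" for \<omega>
      by (simp add: atLeast0_atMost_Suc)
    then show ?case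
      using Suc integrable_S by (auto intro: integrable_max)
  qed (simp add: integrable_S)
  then show ?thesis by (simp add: walk_max_def[abs_def])
qed

lemma expectation_pos_part_le_L:
  assumes "n \<le> N"
  shows "expectation (\<lambda>\<omega>. max (S n \<omega>) 0) \<le> expectation (L N)"
proof (intro integral_mono integrable_pos_part_S integrable_L)
  fix \<omega>
  have "S n \<omega> \<le> L N \<omega>" and "S 0 \<omega> \<le> L N \<omega>"
    unfolding walk_max_def using assms by (auto intro!: Max_ge)
  then show "max (S n \<omega>) 0 \<le> L N \<omega>"
    by (simp add: walk_def)
qed

text \<open>
  The drift is nondecreasing in time, so giving every \<open>S j\<close> the drift of time \<open>N\<close> can only increase
  the maximum; what remains is the maximum of the driftless walk.
\<close>

lemma expectation_L_le:
  "expectation (L N) \<le> 2 * \<sigma> * G 0 * sqrt (real N) + \<bar>\<kappa>\<bar> * \<sigma> * real N powr \<alpha>"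
proof -
  let ?M = "\<lambda>\<omega>. Max ((\<lambda>j. W j \<omega>) ` {0..N})"
  have M: "integrable M ?M"
  proof -
    have "?M = (\<lambda>\<omega>. drawdown (\<lambda>i. Z i \<omega>) N + W N \<omega>)"
      by (simp add: fun_eq_iff drawdown_eq_Max_minus W_def)
    then show ?thesis
      using integrable_drawdown integrable_step integrable_W by auto
  qed
  have "expectation (L N) \<le> expectation (\<lambda>\<omega>. \<sigma> * ?M \<omega> + \<bar>\<kappa>\<bar> * \<sigma> * real N powr \<alpha>)"
  proof (intro integral_mono integrable_L)
    show "integrable M (\<lambda>\<omega>. \<sigma> * ?M \<omega> + \<bar>\<kappa>\<bar> * \<sigma> * real N powr \<alpha>)"
      using M by auto
    fix \<omega>
    have "S j \<omega> \<le> \<sigma> * ?M \<omega> + \<bar>\<kappa>\<bar> * \<sigma> * real N powr \<alpha>" if "j \<le> N" for j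
      unfolding S_eq using that \<sigma>_pos \<alpha>_nonneg
      by (intro add_mono mult_left_mono powr_mono2 Max_ge) auto
    then show "L N \<omega> \<le> \<sigma> * ?M \<omega> + \<bar>\<kappa>\<bar> * \<sigma> * real N powr \<alpha>"
      unfolding walk_max_def by (intro Max.boundedI) auto
  qed
  also have "\<dots> = \<sigma> * expectation ?M + \<bar>\<kappa>\<bar> * \<sigma> * real N powr \<alpha>"
    using M by (simp add: prob_space)
  also have "expectation ?M \<le> expectation (\<lambda>\<omega>. \<bar>W N \<omega>\<bar>)"
    unfolding W_def
    by (intro expectation_Max_partial_sums_le indep_steps integrable_step
        distr_uminus_std_normal step_distributed)
  also have "\<dots> = 2 * G 0 * sqrt (real N)"
    by (rule expectation_abs_W)
  finally show ?thesis
    using \<sigma>_pos by (simp add: mult_ac)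
qed

end

section \<open>Orders of growth\<close>

lemma grows_on_orderI:
  assumes "0 < c" and "\<And>N. N \<ge> 1 \<Longrightarrow> 0 < f N"
    and bounds: "\<And>N::nat. N \<ge> 1 \<Longrightarrow> c * f N \<le> a N \<and> a N \<le> d * f N"
  shows "grows_on_order a f"
proof -
  have "c * f 1 \<le> d * f 1"
    using bounds[of 1] by linarith
  then have "c \<le> d"
    using assms(2)[of 1] by simp
  then show ?thesis
    unfolding grows_on_order_def
    using assms by (intro exI[of _ c] exI[of _ d]) (auto intro!: eventually_sequentiallyI[of 1])
qed

context gaussian_walk
begin

lemma Max_expectation_pos_part_bounds:
  defines "m \<equiv> \<lambda>N. Max ((\<lambda>n. expectation (\<lambda>\<omega>. max (S n \<omega>) 0)) ` {0..N})"
  shows "\<bar>\<kappa>\<bar> * \<sigma> * real N powr \<alpha> \<le> m N"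
    and "m N \<le> \<sigma> * G 0 * sqrt (real N) + \<bar>\<kappa>\<bar> * \<sigma> * real N powr \<alpha>"
proof -
  show "\<bar>\<kappa>\<bar> * \<sigma> * real N powr \<alpha> \<le> m N"
    unfolding m_def by (rule order_trans[OF drift_le_expectation_pos_part]) (auto intro!: Max_ge)
  have "expectation (\<lambda>\<omega>. max (S n \<omega>) 0) \<le> \<sigma> * G 0 * sqrt (real N) + \<bar>\<kappa>\<bar> * \<sigma> * real N powr \<alpha>"
    if "n \<le> N" for n
    using that \<sigma>_pos \<alpha>_nonneg G_0_pos
    by (intro order_trans[OF expectation_pos_part_le] add_mono mult_left_mono powr_mono2) auto
  then show "m N \<le> \<sigma> * G 0 * sqrt (real N) + \<bar>\<kappa>\<bar> * \<sigma> * real N powr \<alpha>"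
    unfolding m_def by (intro Max.boundedI) auto
qed

text \<open>
  The two bounds of \<open>Max_expectation_pos_part_bounds\<close> share the drift term.  Relative to it, the
  fluctuation term of the upper one decays like \<open>N\<close> to the power \<open>1/2 - \<alpha> < 0\<close>.
\<close>

lemma Max_expectation_pos_part_asymp_equiv:
  assumes "\<alpha> > 1/2"
  shows "(\<lambda>N. Max ((\<lambda>n. expectation (\<lambda>\<omega>. max (S n \<omega>) 0)) ` {0..N}))
    \<sim>[sequentially] (\<lambda>N. \<sigma> * \<bar>\<kappa>\<bar> * real N powr \<alpha>)"
    (is "?m \<sim>[_] ?b")
proof (rule asymp_equivI')
  let ?u = "\<lambda>N. 1 + G 0 / \<bar>\<kappa>\<bar> * real N powr (1/2 - \<alpha>)"
  have "?u \<longlonglongrightarrow> 1 + G 0 / \<bar>\<kappa>\<bar> * 0"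
    using assms
    by (intro tendsto_intros tendsto_neg_powr filterlim_real_sequentially) auto
  then have u: "?u \<longlonglongrightarrow> 1" by simp
  have bounds: "1 \<le> ?m N / ?b N \<and> ?m N / ?b N \<le> ?u N" if "N \<ge> 1" for N
  proof
    have pos: "?b N > 0"
      using that \<sigma>_pos \<kappa>_neg by (intro mult_pos_pos) auto
    show "1 \<le> ?m N / ?b N"
      using Max_expectation_pos_part_bounds(1)[of N] pos by (simp add: mult_ac)
    have "sqrt (real N) = real N powr \<alpha> * real N powr (1/2 - \<alpha>)"
      using that by (simp add: powr_add[symmetric] powr_half_sqrt)
    then have "\<sigma> * G 0 * sqrt (real N) + \<bar>\<kappa>\<bar> * \<sigma> * real N powr \<alpha> = ?u N * ?b N"
      using \<kappa>_neg by (simp add: field_simps)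
    with Max_expectation_pos_part_bounds(2)[of N] have "?m N \<le> ?u N * ?b N"
      by simp
    with pos show "?m N / ?b N \<le> ?u N"
      by (simp only: pos_divide_le_eq)
  qed
  show "(\<lambda>N. ?m N / ?b N) \<longlonglongrightarrow> 1"
    by (rule tendsto_sandwich[OF _ _ tendsto_const u])
      (use bounds in \<open>auto intro!: eventually_sequentiallyI[of 1]\<close>)
qed

lemma growth_supercritical:
  assumes "\<alpha> > 1/2"
  shows "grows_on_order (\<lambda>N. expectation (L N)) (\<lambda>N. \<sigma> * \<bar>\<kappa>\<bar> * real N powr \<alpha>)"
proof (rule grows_on_orderI[where c=1 and d="2 * G 0 / \<bar>\<kappa>\<bar> + 1"])
  fix N :: nat
  assume N: "N \<ge> 1"
  show "0 < \<sigma> * \<bar>\<kappa>\<bar> * real N powr \<alpha>"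
    using \<sigma>_pos \<kappa>_neg N by (intro mult_pos_pos) auto
  have "sqrt (real N) \<le> real N powr \<alpha>"
    using assms N powr_mono[of "1/2" \<alpha> "real N"] by (simp add: powr_half_sqrt)
  then have "2 * \<sigma> * G 0 * sqrt (real N) \<le> 2 * \<sigma> * G 0 * real N powr \<alpha>"
    using \<sigma>_pos G_0_pos by (intro mult_left_mono) auto
  then have "expectation (L N) \<le> 2 * \<sigma> * G 0 * real N powr \<alpha> + \<bar>\<kappa>\<bar> * \<sigma> * real N powr \<alpha>"
    using expectation_L_le[of N] by linarith
  also have "\<dots> = (2 * G 0 / \<bar>\<kappa>\<bar> + 1) * (\<sigma> * \<bar>\<kappa>\<bar> * real N powr \<alpha>)"
    using \<kappa>_neg by (simp add: field_simps)
  finally show "1 * (\<sigma> * \<bar>\<kappa>\<bar> * real N powr \<alpha>) \<le> expectation (L N) \<and>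
      expectation (L N) \<le> (2 * G 0 / \<bar>\<kappa>\<bar> + 1) * (\<sigma> * \<bar>\<kappa>\<bar> * real N powr \<alpha>)"
    using order_trans[OF drift_le_expectation_pos_part expectation_pos_part_le_L[OF order_refl]]
    by (simp add: mult_ac)
qed simp

text \<open>
  For \<open>\<alpha> \<le> 1/2\<close> the drift term of the upper bound is at most of order \<open>\<surd>N\<close>.  The constant \<open>g\<close>
  is \<open>G 0\<close> for \<open>\<alpha> < 1/2\<close> and \<open>G \<kappa>\<close> for \<open>\<alpha> = 1/2\<close>.
\<close>

lemma growth_sqrt:
  assumes "\<alpha> \<le> 1/2" and "g > 0"
    and lower: "\<And>N. \<sigma> * g * sqrt (real N) \<le> expectation (L N)"
  shows "grows_on_order (\<lambda>N. expectation (L N)) (\<lambda>N. \<sigma> * g * sqrt (real N))"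
proof (rule grows_on_orderI[where c=1 and d="(2 * G 0 + \<bar>\<kappa>\<bar>) / g"])
  fix N :: nat
  assume N: "N \<ge> 1"
  show "0 < \<sigma> * g * sqrt (real N)"
    using \<sigma>_pos \<open>g > 0\<close> N by simp
  have "real N powr \<alpha> \<le> sqrt (real N)"
    using assms N powr_mono[of \<alpha> "1/2" "real N"] by (simp add: powr_half_sqrt)
  then have "\<bar>\<kappa>\<bar> * \<sigma> * real N powr \<alpha> \<le> \<bar>\<kappa>\<bar> * \<sigma> * sqrt (real N)"
    using \<sigma>_pos by (intro mult_left_mono) auto
  then have "expectation (L N) \<le> 2 * \<sigma> * G 0 * sqrt (real N) + \<bar>\<kappa>\<bar> * \<sigma> * sqrt (real N)"
    using expectation_L_le[of N] by linarith
  also have "\<dots> = (2 * G 0 + \<bar>\<kappa>\<bar>) / g * (\<sigma> * g * sqrt (real N))"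
    using \<open>g > 0\<close> by (simp add: field_simps)
  finally show "1 * (\<sigma> * g * sqrt (real N)) \<le> expectation (L N) \<and>
      expectation (L N) \<le> (2 * G 0 + \<bar>\<kappa>\<bar>) / g * (\<sigma> * g * sqrt (real N))"
    using lower by simp
qed simp

lemma sqrt_lower_bound: "\<sigma> * G 0 * sqrt (real N) \<le> expectation (L N)"
  by (rule order_trans[OF fluctuation_le_expectation_pos_part expectation_pos_part_le_L[OF order_refl]])

lemma sqrt_lower_bound_critical: "\<alpha> = 1/2 \<Longrightarrow> \<sigma> * G \<kappa> * sqrt (real N) \<le> expectation (L N)"
  using expectation_pos_part_critical expectation_pos_part_le_L[OF order_refl] by metis

lemma Max_expectation_pos_part_le_L:
  "Max ((\<lambda>n. expectation (\<lambda>\<omega>. max (S n \<omega>) 0)) ` {0..N}) \<le> expectation (L N)"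
  by (intro Max.boundedI) (auto intro: expectation_pos_part_le_L)

end

theorem proposition5:
  fixes M :: "'a measure" and Z :: "nat \<Rightarrow> 'a \<Rightarrow> real" and \<sigma> \<kappa> \<alpha> :: real
  defines "S \<equiv> walk \<sigma> \<kappa> \<alpha> Z" and "L \<equiv> walk_max \<sigma> \<kappa> \<alpha> Z"
  assumes "prob_space M"
    and "\<sigma> > 0" and "\<kappa> < 0" and "0 \<le> \<alpha>" and "\<alpha> < 1"
    and "prob_space.indep_vars M (\<lambda>_. borel) Z {1..}"
    and "\<And>i. i \<ge> 1 \<Longrightarrow> distributed M lborel (Z i) std_normal_density"
  shows "(\<alpha> > 1/2 \<longrightarrow> grows_on_order (\<lambda>N. \<integral>\<omega>. L N \<omega> \<partial>M) (\<lambda>N. \<sigma> * \<bar>\<kappa>\<bar> * real N powr \<alpha>)) \<and>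
    (\<alpha> < 1/2 \<longrightarrow> grows_on_order (\<lambda>N. \<integral>\<omega>. L N \<omega> \<partial>M) (\<lambda>N. \<sigma> * G 0 * sqrt (real N))) \<and>
    (\<alpha> = 1/2 \<longrightarrow> grows_on_order (\<lambda>N. \<integral>\<omega>. L N \<omega> \<partial>M) (\<lambda>N. \<sigma> * G \<kappa> * sqrt (real N))) \<and>
    (\<alpha> > 1/2 \<longrightarrow>
      (\<forall>\<^sub>F N in sequentially.
         (\<integral>\<omega>. L N \<omega> \<partial>M) \<ge> Max ((\<lambda>n. \<integral>\<omega>. max (S n \<omega>) 0 \<partial>M) ` {0..N})) \<and>
      (\<lambda>N. Max ((\<lambda>n. \<integral>\<omega>. max (S n \<omega>) 0 \<partial>M) ` {0..N}))
         \<sim>[sequentially] (\<lambda>N. \<sigma> * \<bar>\<kappa>\<bar> * real N powr \<alpha>)) \<and>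
    (\<alpha> = 1/2 \<longrightarrow> (\<forall>\<^sub>F N in sequentially. (\<integral>\<omega>. L N \<omega> \<partial>M) \<ge> \<sigma> * G \<kappa> * sqrt (real N))) \<and>
    (\<alpha> < 1/2 \<longrightarrow> (\<forall>\<^sub>F N in sequentially. (\<integral>\<omega>. L N \<omega> \<partial>M) \<ge> \<sigma> * G 0 * sqrt (real N))) \<and>
    (\<forall>N. (\<integral>\<omega>. L N \<omega> \<partial>M) \<le> 2 * \<sigma> * G 0 * sqrt (real N) + \<bar>\<kappa>\<bar> * \<sigma> * real N powr \<alpha>)"
proof -
  interpret gaussian_walk M Z \<sigma> \<kappa> \<alpha>
    using assms by (auto simp: gaussian_walk_def gaussian_walk_axioms_def)
  have "\<alpha> = 1/2 \<longrightarrow> grows_on_order (\<lambda>N. \<integral>\<omega>. L N \<omega> \<partial>M) (\<lambda>N. \<sigma> * G \<kappa> * sqrt (real N))"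
    using growth_sqrt[OF _ G_pos_if_nonpos sqrt_lower_bound_critical] \<open>\<kappa> < 0\<close>
    unfolding L_def by simp
  moreover have "\<alpha> < 1/2 \<longrightarrow> grows_on_order (\<lambda>N. \<integral>\<omega>. L N \<omega> \<partial>M) (\<lambda>N. \<sigma> * G 0 * sqrt (real N))"
    using growth_sqrt[OF _ G_0_pos sqrt_lower_bound]
    unfolding L_def by simp
  ultimately show ?thesis
    unfolding S_def L_def
    using growth_supercritical Max_expectation_pos_part_le_L Max_expectation_pos_part_asymp_equiv
      sqrt_lower_bound_critical sqrt_lower_bound expectation_L_le
    by (intro conjI impI allI always_eventually) blast+
qed

end
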